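(* Let $\mathbf{H}\in\mathbb{C}^{K\times N}$ have full row rank $K\le N$, and let $\boldsymbol{\Pi}_{\mathbf H}=\mathbf{H}^{\mathsf H}(\mathbf{H}\mathbf{H}^{\mathsf H})^{-1}\mathbf{H}$. Consider the problem, over $\mathbf{W}\in\mathbb{C}^{N\times K}$ and $\mathbf{p}\in\mathbb{R}^K$, $$\text{(P)}\qquad \max_{\mathbf{W},\mathbf{p}}\ \frac{B\,R(\mathbf{W})}{P_{\mathrm{tot}}(\mathbf{p})}\quad\text{s.t.}\quad \mathbf{W}^{\mathsf H}\mathbf{W}\preceq\operatorname{diag}(\mathbf{p}),\qquad \alpha_q\mathbf{1}^{\mathsf T}\mathbf{p}\le P_{\max}.$$ For any feasible pair $(\mathbf{W},\mathbf{p})$ of (P), let $\mathbf{W}_{\parallel}=\boldsymbol{\Pi}_{\mathbf H}\mathbf{W}$ be the projection of $\mathbf{W}$ onto $\operatorname{Ran}(\mathbf{H}^{\mathsf H})$. Then $(\mathbf{W}_{\parallel},\mathbf{p})$ is feasible for (P), satisfies $\mathbf{H}\mathbf{W}_{\parallel}=\mathbf{H}\mathbf{W}$, and attains the same transmit power $P_{\mathrm{tx}}(\mathbf{p})=\alpha_q\mathbf{1}^{\mathsf T}\mathbf{p}$. Hence (P) always has an optimal solution $(\mathbf{W},\mathbf{p})$ whose beamformer $\mathbf{W}$ lies in $\operatorname{Ran}(\mathbf{H}^{\mathsf H})$ (i.e. all columns of $\mathbf{W}$ belong to $\operatorname{Ran}(\mathbf{H}^{\mathsf H})$).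
   Context: Constants: $B>0$, $\sigma^2>0$, $P_{\max}>0$, $\eta_{\mathrm{PA}}>0$, $P_{\mathrm{st}}>0$ (static power), $\beta_q\in(0,1)$ and $\alpha_q=1-\beta_q$. The $k$th row of $\mathbf{H}$ is $\mathbf{h}_k^{\mathsf H}$ and $\mathbf{w}_k$ is the $k$th column of $\mathbf{W}$. $\preceq$ is the Loewner (positive semidefinite) order on Hermitian matrices, and $\mathbf{1}$ is the all-ones vector. The entries of $\mathbf{p}$ are nonnegative stream powers. Sum rate: $R(\mathbf{W})=\sum_{k=1}^K\log_2(1+\Gamma_k(\mathbf{W}))$ with $$\Gamma_k(\mathbf{W})=\frac{\alpha_q^2|\mathbf{h}_k^{\mathsf H}\mathbf{w}_k|^2}{\alpha_q^2\sum_{j\ne k}|\mathbf{h}_k^{\mathsf H}\mathbf{w}_j|^2+\mathbf{h}_k^{\mathsf H}\mathbf{R}_q\mathbf{h}_k+\sigma^2},\qquad \mathbf{R}_q=\alpha_q\beta_q\mathbf{W}\mathbf{W}^{\mathsf H}.$$ Transmit power: $P_{\mathrm{tx}}(\mathbf{p})=\alpha_q\mathbf{1}^{\mathsf T}\mathbf{p}$. Total power: $P_{\mathrm{tot}}(\mathbf{p})=P_{\mathrm{tx}}(\mathbf{p})/\eta_{\mathrm{PA}}+P_{\mathrm{st}}$. *)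

theory Defs
  imports "HOL-Analysis.Analysis"
begin

definition cadjoint :: "complex^'n^'m \<Rightarrow> complex^'m^'n" where
  "cadjoint A = (\<chi> i j. cnj (A $ j $ i))"

text \<open>The product \<open>x\<^sup>H y\<close>, conjugate-linear in the first argument; the library operation
  \<open>\<bullet>\<close> on complex vectors is only its real part.\<close>

definition cinner :: "complex^'n \<Rightarrow> complex^'n \<Rightarrow> complex" where
  "cinner x y = (\<Sum>i\<in>UNIV. cnj (x $ i) * y $ i)"

definition cdiag :: "real^'k \<Rightarrow> complex^'k^'k" where
  "cdiag p = (\<chi> i j. if i = j then complex_of_real (p $ i) else 0)"

definition hermitian :: "complex^'k^'k \<Rightarrow> bool" where
  "hermitian A \<longleftrightarrow> cadjoint A = A"

text \<open>For a Hermitian matrix the quadratic form is real, so taking \<open>Re\<close> loses nothing.\<close>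

definition psd :: "complex^'k^'k \<Rightarrow> bool" where
  "psd A \<longleftrightarrow> hermitian A \<and> (\<forall>x. 0 \<le> Re (cinner x (A *v x)))"

definition loewner_le :: "complex^'k^'k \<Rightarrow> complex^'k^'k \<Rightarrow> bool" where
  "loewner_le A B \<longleftrightarrow> hermitian A \<and> hermitian B \<and> psd (B - A)"

text \<open>The channel vector \<open>h\<^sub>k\<close>: it is \<open>h\<^sub>k\<^sup>H\<close>, not \<open>h\<^sub>k\<close>, that is the \<open>k\<close>th row of \<open>H\<close>.\<close>

definition channel :: "complex^'n^'k \<Rightarrow> 'k \<Rightarrow> complex^'n" where
  "channel H k = (\<chi> i. cnj (H $ k $ i))"

definition quant_cov :: "real \<Rightarrow> real \<Rightarrow> complex^'k^'n \<Rightarrow> complex^'n^'n" where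
  "quant_cov aq bq W = (aq * bq) *\<^sub>R (W ** cadjoint W)"

text \<open>The quadratic form \<open>h\<^sub>k\<^sup>H R\<^sub>q h\<^sub>k\<close> is real since \<open>R\<^sub>q\<close> is Hermitian.\<close>

definition sinr ::
  "real \<Rightarrow> real \<Rightarrow> real \<Rightarrow> complex^'n^'k \<Rightarrow> complex^'k^'n \<Rightarrow> 'k \<Rightarrow> real" where
  "sinr aq bq sigma2 H W k =
     aq\<^sup>2 * (cmod (cinner (channel H k) (column k W)))\<^sup>2 /
     (aq\<^sup>2 * (\<Sum>j\<in>UNIV - {k}. (cmod (cinner (channel H k) (column j W)))\<^sup>2)
      + Re (cinner (channel H k) (quant_cov aq bq W *v channel H k)) + sigma2)"

definition sum_rate ::
  "real \<Rightarrow> real \<Rightarrow> real \<Rightarrow> complex^'n^'k \<Rightarrow> complex^'k^'n \<Rightarrow> real" where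
  "sum_rate aq bq sigma2 H W = (\<Sum>k\<in>UNIV. log 2 (1 + sinr aq bq sigma2 H W k))"

text \<open>In \<open>1 \<bullet> p\<close> the constant \<open>1\<close> is the all-ones vector.\<close>

definition tx_power :: "real \<Rightarrow> real^'k \<Rightarrow> real" where
  "tx_power aq p = aq * (1 \<bullet> p)"

definition total_power :: "real \<Rightarrow> real \<Rightarrow> real \<Rightarrow> real^'k \<Rightarrow> real" where
  "total_power aq eta_PA P_st p = tx_power aq p / eta_PA + P_st"

definition energy_efficiency ::
  "real \<Rightarrow> real \<Rightarrow> real \<Rightarrow> real \<Rightarrow> real \<Rightarrow> real \<Rightarrow> complex^'n^'k
    \<Rightarrow> (complex^'k^'n) \<times> (real^'k) \<Rightarrow> real" where
  "energy_efficiency B aq bq sigma2 eta_PA P_st H =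
     (\<lambda>(W, p). B * sum_rate aq bq sigma2 H W / total_power aq eta_PA P_st p)"

text \<open>Nonnegativity of the stream powers is part of their meaning; it also follows from the
  matrix inequality, whose diagonal entries bound \<open>p $ k\<close> from below.\<close>

definition feasible :: "real \<Rightarrow> real \<Rightarrow> (complex^'k^'n) \<times> (real^'k) \<Rightarrow> bool" where
  "feasible aq P_max =
     (\<lambda>(W, p). (\<forall>k. 0 \<le> p $ k) \<and> loewner_le (cadjoint W ** W) (cdiag p)
             \<and> aq * (1 \<bullet> p) \<le> P_max)"

definition optimal ::
  "real \<Rightarrow> real \<Rightarrow> real \<Rightarrow> real \<Rightarrow> real \<Rightarrow> real \<Rightarrow> real \<Rightarrow> complex^'n^'k
    \<Rightarrow> (complex^'k^'n) \<times> (real^'k) \<Rightarrow> bool" where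
  "optimal B aq bq sigma2 eta_PA P_st P_max H =
     is_arg_max (energy_efficiency B aq bq sigma2 eta_PA P_st H) (feasible aq P_max)"

definition proj_matrix :: "complex^'n^'k \<Rightarrow> complex^'n^'n" where
  "proj_matrix H = cadjoint H ** matrix_inv (H ** cadjoint H) ** H"

definition mat_range :: "complex^'m^'n \<Rightarrow> (complex^'n) set" where
  "mat_range A = range (\<lambda>x. A *v x)"

end

theory Submission
  imports Defs
begin

text \<open>
  The SINRs depend on \<open>W\<close> only through \<open>H W\<close>, which the orthogonal projection \<open>\<Pi>\<close> onto the range
  of \<open>H\<^sup>H\<close> preserves because \<open>H \<Pi> = H\<close>. Feasibility says \<open>\<parallel>W x\<parallel>\<^sup>2 \<le> \<Sum>\<^sub>k p\<^sub>k \<bar>x\<^sub>k\<bar>\<^sup>2\<close> for all \<open>x\<close>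
  together with the power budget, and \<open>\<Pi>\<close> does not increase norms. An optimal pair exists by
  compactness: the quadratic inequality at unit vectors bounds the columns of \<open>W\<close> by the powers,
  the powers are bounded by the budget, and the objective is continuous because the noise and
  static power keep all denominators positive. Projecting an optimal pair keeps it optimal.
\<close>

section \<open>Adjoints, the complex inner product and norms\<close>

lemma cadjoint_component [simp]: "cadjoint A $ i $ j = cnj (A $ j $ i)"
  by (simp add: cadjoint_def)

lemma cadjoint_cadjoint [simp]: "cadjoint (cadjoint A) = A"
  by (simp add: vec_eq_iff)

lemma cadjoint_mult: "cadjoint (A ** B) = cadjoint B ** cadjoint A"
  by (simp add: vec_eq_iff matrix_matrix_mult_def mult.commute)

lemma cadjoint_mat_1 [simp]: "cadjoint (mat 1) = mat 1"
  by (simp add: vec_eq_iff mat_def)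

lemma cinner_adjoint: "cinner x (A *v y) = cinner (cadjoint A *v x) y"
  unfolding cinner_def matrix_vector_mult_def
  by (simp add: sum_distrib_left sum_distrib_right mult_ac, rule sum.swap)

lemma cinner_gram: "cinner x (cadjoint A *v (A *v x)) = cinner (A *v x) (A *v x)"
  by (subst cinner_adjoint) simp

lemma cinner_diff_right: "cinner x (y - z) = cinner x y - cinner x z"
  by (simp add: cinner_def algebra_simps sum_subtractf)

lemma cinner_scaleR_right: "cinner x (c *\<^sub>R y) = c *\<^sub>R cinner x y"
  by (simp add: cinner_def scaleR_right.sum)

lemma Re_cinner: "Re (cinner x y) = x \<bullet> y"
  by (simp add: cinner_def inner_vec_def inner_complex_def)

lemma Re_cinner_self: "Re (cinner x x) = (norm x)\<^sup>2"
  by (simp add: Re_cinner power2_norm_eq_inner)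

lemma norm_vec_power2: "(norm x)\<^sup>2 = (\<Sum>i\<in>UNIV. (norm (x $ i))\<^sup>2)"
  by (simp add: norm_vec_def L2_set_def sum_nonneg)

lemma column_matrix_mult: "column k (A ** B) = A *v column k B"
  by (simp add: vec_eq_iff column_def matrix_matrix_mult_def matrix_vector_mult_def)

section \<open>Full row rank and the Gram matrix \<open>H ** cadjoint H\<close>\<close>

text \<open>Without a right inverse the rows satisfy a nontrivial linear relation. Solving it for a
  row with nonzero coefficient puts all rows in the span of the others, so the rank is below
  \<open>CARD('k)\<close>.\<close>

lemma full_row_rank_right_inverse:
  fixes A :: "'a::field^'n^'k"
  assumes "rank A = CARD('k)"
  shows "\<exists>B. A ** B = mat 1"
proof (rule ccontr)
  assume "\<nexists>B. A ** B = mat 1"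
  then obtain c k where c: "(\<Sum>i\<in>UNIV. c i *s row i A) = 0" "c k \<noteq> 0"
    unfolding matrix_right_invertible_independent_rows by blast
  define S where "S = (\<lambda>i. row i A) ` (UNIV - {k})"
  have "c k *s row k A + (\<Sum>i\<in>UNIV - {k}. c i *s row i A) = 0"
    using c(1) by (simp add: sum.remove[of UNIV k])
  then have "c k *s row k A = - (\<Sum>i\<in>UNIV - {k}. c i *s row i A)"
    by (simp add: eq_neg_iff_add_eq_0)
  moreover have "- (\<Sum>i\<in>UNIV - {k}. c i *s row i A) \<in> vec.span S"
    by (intro vec.span_neg vec.span_sum vec.span_scale vec.span_base) (auto simp: S_def)
  ultimately have "inverse (c k) *s (c k *s row k A) \<in> vec.span S"
    using vec.span_scale by metis
  then have "row k A \<in> vec.span S"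
    using c(2) by simp
  then have "rows A \<subseteq> vec.span S"
    unfolding rows_def S_def by (auto intro: vec.span_base)
  moreover have "finite S"
    by (simp add: S_def)
  ultimately have "rank A \<le> card S"
    unfolding row_rank_def_gen by (rule vec.dim_le_card)
  \<comment> \<open>\<open>S\<close> is an image of the remaining indices, so repeated rows can only
    make it smaller.\<close>
  also have "card S \<le> CARD('k) - 1"
    unfolding S_def by (metis card_Diff_singleton card_image_le finite iso_tuple_UNIV_I)
  also have "\<dots> < CARD('k)"
    by simp
  finally show False
    using assms by simp
qed

text \<open>The kernel is trivial: pairing \<open>(H ** cadjoint H) *v x = 0\<close> with
  \<open>x\<close> gives \<open>cadjoint H *v x = 0\<close>, and the adjoint of a right inverse of
  \<open>H\<close> is a left inverse of \<open>cadjoint H\<close>.\<close>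

lemma invertible_gram:
  fixes H :: "complex^'n^'k"
  assumes "rank H = CARD('k)"
  shows "invertible (H ** cadjoint H)"
proof -
  obtain B where "H ** B = mat 1"
    using full_row_rank_right_inverse[OF assms] by blast
  then have B: "cadjoint B ** cadjoint H = mat 1"
    by (metis cadjoint_mult cadjoint_mat_1)
  have "x = 0" if x: "(H ** cadjoint H) *v x = 0" for x
  proof -
    have "(norm (cadjoint H *v x))\<^sup>2 = Re (cinner x (H *v (cadjoint H *v x)))"
      using cinner_gram[of x "cadjoint H"] by (simp add: Re_cinner_self)
    also have "\<dots> = 0"
      using x by (simp add: matrix_vector_mul_assoc cinner_def)
    finally have "cadjoint H *v x = 0"
      by simp
    then show "x = 0"
      using B by (metis matrix_vector_mul_assoc matrix_vector_mul_lid matrix_vector_mult_0_right)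
  qed
  then show ?thesis
    unfolding invertible_left_inverse matrix_left_invertible_ker by blast
qed

text \<open>\<open>matrix_inv\<close> is a choice of two-sided inverse, so its equations rest on
  invertibility. Since the Gram matrix is Hermitian, the adjoint of its inverse is a left inverse,
  and a left inverse agrees with a right inverse.\<close>

lemma matrix_inv_gram:
  fixes H :: "complex^'n^'k"
  assumes "rank H = CARD('k)"
  shows "(H ** cadjoint H) ** matrix_inv (H ** cadjoint H) = mat 1"
    and "cadjoint (matrix_inv (H ** cadjoint H)) = matrix_inv (H ** cadjoint H)"
proof -
  define G where "G = H ** cadjoint H"
  have G: "cadjoint G = G"
    by (simp add: G_def cadjoint_mult)
  have "\<exists>M. G ** M = mat 1 \<and> M ** G = mat 1"
    using invertible_gram[OF assms] by (simp add: invertible_def G_def)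
  then have inv: "G ** matrix_inv G = mat 1"
    unfolding matrix_inv_def by (rule someI2_ex) blast
  then have "cadjoint (matrix_inv G) ** G = mat 1"
    by (metis G cadjoint_mult cadjoint_mat_1)
  then have "cadjoint (matrix_inv G) = matrix_inv G"
    by (metis inv matrix_mul_assoc matrix_mul_lid matrix_mul_rid)
  with inv show "(H ** cadjoint H) ** matrix_inv (H ** cadjoint H) = mat 1"
    and "cadjoint (matrix_inv (H ** cadjoint H)) = matrix_inv (H ** cadjoint H)"
    by (simp_all add: G_def)
qed

section \<open>The orthogonal projection onto the range of \<open>cadjoint H\<close>\<close>

lemma mult_proj_matrix:
  fixes H :: "complex^'n^'k"
  assumes "rank H = CARD('k)"
  shows "H ** proj_matrix H = H"
  by (simp add: proj_matrix_def matrix_mul_assoc matrix_inv_gram(1)[OF assms])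

lemma cadjoint_proj_matrix:
  fixes H :: "complex^'n^'k"
  assumes "rank H = CARD('k)"
  shows "cadjoint (proj_matrix H) = proj_matrix H"
  by (simp add: proj_matrix_def cadjoint_mult matrix_inv_gram(2)[OF assms] matrix_mul_assoc)

lemma proj_matrix_idem:
  fixes H :: "complex^'n^'k"
  assumes "rank H = CARD('k)"
  shows "proj_matrix H ** proj_matrix H = proj_matrix H"
proof -
  have "proj_matrix H ** proj_matrix H
      = cadjoint H ** matrix_inv (H ** cadjoint H) ** (H ** proj_matrix H)"
    by (metis proj_matrix_def matrix_mul_assoc)
  then show ?thesis
    using mult_proj_matrix[OF assms] by (metis proj_matrix_def)
qed

text \<open>A self-adjoint idempotent \<open>P\<close> satisfies
  \<open>(norm (P *v v))\<^sup>2 = v \<bullet> (P *v v)\<close>. Cauchy-Schwarz bounds this by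
  \<open>norm v * norm (P *v v)\<close>, and one factor cancels unless it is zero.\<close>

lemma norm_proj_matrix_le:
  fixes H :: "complex^'n^'k"
  assumes "rank H = CARD('k)"
  shows "norm (proj_matrix H *v v) \<le> norm v"
proof -
  let ?P = "proj_matrix H"
  have "(norm (?P *v v))\<^sup>2 = Re (cinner (?P *v v) (?P *v v))"
    by (simp add: Re_cinner_self)
  also have "\<dots> = Re (cinner v (?P *v (?P *v v)))"
    by (simp add: cinner_adjoint cadjoint_proj_matrix[OF assms])
  also have "\<dots> = v \<bullet> (?P *v v)"
    by (simp add: matrix_vector_mul_assoc proj_matrix_idem[OF assms] Re_cinner)
  also have "\<dots> \<le> norm v * norm (?P *v v)"
    by (rule norm_cauchy_schwarz)
  finally show ?thesis
    by (cases "norm (?P *v v) = 0") (auto simp: power2_eq_square)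
qed

lemma proj_matrix_in_range: "proj_matrix H *v v \<in> mat_range (cadjoint H)"
  by (auto simp: mat_range_def proj_matrix_def simp flip: matrix_vector_mul_assoc)

text \<open>The residual lies in the kernel of \<open>H\<close>, which is orthogonal to the range of
  \<open>cadjoint H\<close>. Together with \<open>proj_matrix_in_range\<close> this identifies
  \<open>proj_matrix H *v w\<close> as the orthogonal projection of \<open>w\<close>.\<close>

lemma proj_matrix_orthogonal:
  fixes H :: "complex^'n^'k"
  assumes "rank H = CARD('k)" and "v \<in> mat_range (cadjoint H)"
  shows "cinner v (w - proj_matrix H *v w) = 0"
proof -
  obtain x where x: "v = cadjoint H *v x"
    using assms(2) by (auto simp: mat_range_def)
  have "H *v (proj_matrix H *v w) = H *v w"
    by (simp add: matrix_vector_mul_assoc mult_proj_matrix[OF assms(1)])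
  then show ?thesis
    by (simp add: x cinner_diff_right flip: cinner_adjoint)
qed

section \<open>Feasibility as a family of scalar inequalities\<close>

lemma cdiag_quadratic_form:
  "Re (cinner x (cdiag p *v x)) = (\<Sum>k\<in>UNIV. p $ k * (cmod (x $ k))\<^sup>2)"
proof -
  have "(cdiag p *v x) $ k = complex_of_real (p $ k) * x $ k" for k
    by (simp add: cdiag_def matrix_vector_mult_def if_distrib[of "\<lambda>z. z * _"] cong: if_cong)
  then show ?thesis
    by (simp add: cinner_def cmod_power2 algebra_simps) (simp add: power2_eq_square)
qed

text \<open>Both matrices are Hermitian, and the quadratic form of \<open>cadjoint W ** W\<close> at
  \<open>x\<close> is the squared norm of \<open>W *v x\<close>.\<close>

lemma loewner_le_gram_cdiag_iff:
  "loewner_le (cadjoint W ** W) (cdiag p) \<longleftrightarrow>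
     (\<forall>x. (norm (W *v x))\<^sup>2 \<le> (\<Sum>k\<in>UNIV. p $ k * (cmod (x $ k))\<^sup>2))"
proof -
  have "hermitian (cadjoint W ** W)" "hermitian (cdiag p)"
    by (simp_all add: hermitian_def cadjoint_mult) (auto simp: vec_eq_iff cdiag_def)
  moreover from this have "hermitian (cdiag p - cadjoint W ** W)"
    by (simp add: hermitian_def vec_eq_iff)
  moreover have "Re (cinner x ((cdiag p - cadjoint W ** W) *v x))
      = (\<Sum>k\<in>UNIV. p $ k * (cmod (x $ k))\<^sup>2) - (norm (W *v x))\<^sup>2" for x
    by (simp add: matrix_vector_mult_diff_rdistrib cinner_diff_right cdiag_quadratic_form
        cinner_gram Re_cinner_self flip: matrix_vector_mul_assoc)
  ultimately show ?thesis
    by (simp add: loewner_le_def psd_def)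
qed

lemma feasible_iff:
  "feasible aq P_max (W, p) \<longleftrightarrow> (\<forall>k. 0 \<le> p $ k)
     \<and> (\<forall>x. (norm (W *v x))\<^sup>2 \<le> (\<Sum>k\<in>UNIV. p $ k * (cmod (x $ k))\<^sup>2))
     \<and> aq * (1 \<bullet> p) \<le> P_max"
  by (simp add: feasible_def loewner_le_gram_cdiag_iff)

lemma feasible_proj_matrix:
  fixes H :: "complex^'n^'k"
  assumes "rank H = CARD('k)" and "feasible aq P_max (W, p)"
  shows "feasible aq P_max (proj_matrix H ** W, p)"
proof -
  have "(norm ((proj_matrix H ** W) *v x))\<^sup>2 \<le> (norm (W *v x))\<^sup>2" for x
    using norm_proj_matrix_le[OF assms(1), of "W *v x"]
    by (simp add: power_mono flip: matrix_vector_mul_assoc)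
  then show ?thesis
    using assms(2) unfolding feasible_iff by (meson order_trans)
qed

section \<open>The objective as a function of \<open>H ** W\<close> and the powers\<close>

text \<open>The conjugations in \<open>cinner\<close> and \<open>channel\<close> cancel, leaving the
  \<open>k\<close>th row of \<open>H\<close>.\<close>

lemma cinner_channel: "cinner (channel H k) v = (H *v v) $ k"
  by (simp add: cinner_def channel_def matrix_vector_mult_def)

lemma cinner_channel_column: "cinner (channel H k) (column j W) = (H ** W) $ k $ j"
  by (simp add: cinner_channel matrix_matrix_mult_def matrix_vector_mult_def column_def)

text \<open>The form is a multiple of the squared norm of \<open>cadjoint W *v channel H k\<close>,
  whose entries are the conjugates of row \<open>k\<close> of \<open>H ** W\<close>.\<close>

lemma quant_cov_quadratic_form:
  "Re (cinner (channel H k) (quant_cov aq bq W *v channel H k))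
     = aq * bq * (\<Sum>j\<in>UNIV. (cmod ((H ** W) $ k $ j))\<^sup>2)"
proof -
  let ?h = "channel H k"
  have "(cadjoint W *v ?h) $ j = cnj ((H ** W) $ k $ j)" for j
    by (simp add: matrix_vector_mult_def matrix_matrix_mult_def channel_def mult.commute)
  then have "(norm (cadjoint W *v ?h))\<^sup>2 = (\<Sum>j\<in>UNIV. (cmod ((H ** W) $ k $ j))\<^sup>2)"
    by (simp add: norm_vec_power2)
  moreover have "quant_cov aq bq W *v ?h = (aq * bq) *\<^sub>R (W *v (cadjoint W *v ?h))"
    unfolding quant_cov_def matrix_vector_mul_assoc
    by (simp add: vec_eq_iff matrix_vector_mult_def scaleR_right.sum)
  ultimately show ?thesis
    using cinner_gram[of ?h "cadjoint W"] by (simp add: cinner_scaleR_right Re_cinner_self)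
qed

lemma sinr_eq:
  "sinr aq bq sigma2 H W k =
     aq\<^sup>2 * (cmod ((H ** W) $ k $ k))\<^sup>2 /
     (aq\<^sup>2 * (\<Sum>j\<in>UNIV - {k}. (cmod ((H ** W) $ k $ j))\<^sup>2)
      + aq * bq * (\<Sum>j\<in>UNIV. (cmod ((H ** W) $ k $ j))\<^sup>2) + sigma2)"
  by (simp add: sinr_def cinner_channel_column quant_cov_quadratic_form)

lemma energy_efficiency_cong:
  assumes "H ** W = H ** W'"
  shows "energy_efficiency B aq bq sigma2 eta_PA P_st H (W, p)
       = energy_efficiency B aq bq sigma2 eta_PA P_st H (W', p)"
  by (simp add: energy_efficiency_def sum_rate_def sinr_eq assms)

section \<open>Positivity and continuity of the objective\<close>

lemma sinr_denominator_pos: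
  fixes aq bq sigma2 :: real
  assumes "0 \<le> aq" "0 \<le> bq" "0 < sigma2"
  shows "0 < aq\<^sup>2 * (\<Sum>j\<in>S. (f j)\<^sup>2) + aq * bq * (\<Sum>j\<in>T. (f j)\<^sup>2) + sigma2"
  using assms by (intro add_nonneg_pos add_nonneg_nonneg mult_nonneg_nonneg sum_nonneg) auto

lemma continuous_on_matrix_mult_right [continuous_intros]:
  fixes A :: "'a::real_normed_algebra_1^'n^'m" and f :: "_ \<Rightarrow> 'a^'k^'n"
  assumes "continuous_on S f"
  shows "continuous_on S (\<lambda>x. A ** f x)"
  unfolding matrix_matrix_mult_def by (intro continuous_intros assms)

lemma continuous_on_matrix_vector_mult_left [continuous_intros]:
  fixes f :: "_ \<Rightarrow> 'a::real_normed_algebra_1^'n^'m"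
  assumes "continuous_on S f"
  shows "continuous_on S (\<lambda>x. f x *v v)"
  unfolding matrix_vector_mult_def by (intro continuous_intros assms)

lemma continuous_on_sinr:
  assumes "0 \<le> aq" "0 \<le> bq" "0 < sigma2"
  shows "continuous_on S (\<lambda>W. sinr aq bq sigma2 H W k)"
  unfolding sinr_eq
  by (intro continuous_intros) (metis sinr_denominator_pos[OF assms] less_irrefl)

lemma sinr_nonneg:
  assumes "0 \<le> aq" "0 \<le> bq" "0 < sigma2"
  shows "0 \<le> sinr aq bq sigma2 H W k"
  unfolding sinr_eq
  by (intro divide_nonneg_nonneg less_imp_le[OF sinr_denominator_pos[OF assms]]) simp

lemma feasible_total_power_pos:
  assumes "0 \<le> aq" "0 < eta_PA" "0 < P_st" "feasible aq P_max (W, p)"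
  shows "0 < total_power aq eta_PA P_st p"
proof -
  have "0 \<le> 1 \<bullet> p"
    using assms(4) by (auto simp: feasible_iff inner_vec_def intro: sum_nonneg)
  then show ?thesis
    using assms by (simp add: total_power_def tx_power_def add_nonneg_pos)
qed

text \<open>The logarithms have arguments at least 1 because the SINRs are nonnegative. The total
  power is known to be positive on the feasible set, where the stream powers are
  nonnegative.\<close>

lemma continuous_on_energy_efficiency:
  assumes "0 \<le> aq" "0 \<le> bq" "0 < sigma2" "0 < eta_PA" "0 < P_st"
  shows "continuous_on (Collect (feasible aq P_max))
           (energy_efficiency B aq bq sigma2 eta_PA P_st H)"
proof -
  have sinr: "continuous_on S (\<lambda>x. sinr aq bq sigma2 H (fst x) k)"
    for S :: "((complex^'a^'b) \<times> (real^'a)) set" and k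
    by (rule continuous_on_compose2[OF continuous_on_sinr[OF assms(1-3), of UNIV H k]
          continuous_on_fst[OF continuous_on_id]]) simp
  have pos: "0 < 1 + sinr aq bq sigma2 H W k" for W :: "complex^'a^'b" and k
    using sinr_nonneg[OF assms(1-3), of H W k] by linarith
  have tot: "total_power aq eta_PA P_st (snd x) \<noteq> 0" if "feasible aq P_max x"
    for x :: "(complex^'a^'b) \<times> (real^'a)"
    using feasible_total_power_pos[OF assms(1,4,5), of P_max "fst x" "snd x"] that by simp
  have "continuous_on (Collect (feasible aq P_max))
          (\<lambda>x. B * (\<Sum>k\<in>UNIV. log 2 (1 + sinr aq bq sigma2 H (fst x) k))
               / total_power aq eta_PA P_st (snd x))"
    using tot pos[THEN less_imp_neq] unfolding total_power_def tx_power_def log_def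
    by (intro continuous_intros sinr) (use assms(4) in \<open>auto simp: eq_commute[of 0]\<close>)
  then show ?thesis
    by (simp add: energy_efficiency_def sum_rate_def case_prod_beta)
qed

section \<open>Compactness of the feasible set\<close>

text \<open>For each fixed \<open>x\<close> the quadratic inequality compares continuous functions
  of \<open>(W, p)\<close>, so the feasible set is an intersection of closed sets.\<close>

lemma closed_feasible:
  fixes aq P_max :: real
  shows "closed (Collect (feasible aq P_max :: (complex^'k^'n) \<times> (real^'k) \<Rightarrow> bool))"
proof -
  have iff: "feasible aq P_max z \<longleftrightarrow> (\<forall>k. 0 \<le> snd z $ k)
     \<and> (\<forall>x. (norm (fst z *v x))\<^sup>2 \<le> (\<Sum>k\<in>UNIV. snd z $ k * (cmod (x $ k))\<^sup>2))
     \<and> aq * (1 \<bullet> snd z) \<le> P_max" for z :: "(complex^'k^'n) \<times> (real^'k)"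
    by (cases z) (simp add: feasible_iff)
  show ?thesis
    unfolding iff
    by (intro closed_Collect_conj closed_Collect_all closed_Collect_le continuous_intros)
qed

lemma feasible_power_le:
  assumes "0 < aq" "feasible aq P_max (W, p)"
  shows "p $ k \<le> P_max / aq"
proof -
  have "p $ k \<le> (\<Sum>i\<in>UNIV. p $ i)"
    using assms(2) by (intro member_le_sum) (auto simp: feasible_iff)
  also have "\<dots> = 1 \<bullet> p"
    by (simp add: inner_vec_def)
  also have "\<dots> \<le> P_max / aq"
    using assms by (simp add: feasible_iff pos_le_divide_eq mult.commute)
  finally show ?thesis .
qed

text \<open>This is the quadratic inequality at the unit vector \<open>axis k 1\<close>.\<close>

lemma feasible_norm_column_le:
  assumes "feasible aq P_max (W, p)"
  shows "(norm (column k W))\<^sup>2 \<le> p $ k"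
proof -
  have "W *v axis k 1 = column k W"
    by (simp add: vec_eq_iff matrix_vector_mult_def axis_def column_def
        if_distrib[of "\<lambda>z. _ * z"] cong: if_cong)
  moreover have "(\<Sum>i\<in>UNIV. p $ i * (cmod (axis k 1 $ i))\<^sup>2) = p $ k"
    by (simp add: axis_def if_distrib[of cmod] if_distrib[of "\<lambda>z. z\<^sup>2"]
        if_distrib[of "\<lambda>z. _ * z"] cong: if_cong)
  ultimately show ?thesis
    using assms unfolding feasible_iff by metis
qed

lemma bounded_feasible:
  fixes aq P_max :: real
  assumes "0 < aq"
  shows "bounded (Collect (feasible aq P_max :: (complex^'k^'n) \<times> (real^'k) \<Rightarrow> bool))"
proof -
  define c where "c = P_max / aq"
  \<comment> \<open>The square root bounds the Frobenius norm of \<open>W\<close>, each entry of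
    which has squared modulus at most \<open>c\<close>; the other summand bounds the l1 norm of
    \<open>p\<close>.\<close>
  have "norm z \<le> sqrt (\<Sum>i\<in>(UNIV :: 'n set). \<Sum>k\<in>(UNIV :: 'k set). c) + real CARD('k) * c"
    if z: "feasible aq P_max z" for z :: "(complex^'k^'n) \<times> (real^'k)"
  proof -
    obtain W p where [simp]: "z = (W, p)"
      by (cases z)
    have p: "0 \<le> p $ k" "p $ k \<le> c" for k
      using feasible_power_le[OF assms, of P_max W p k] z by (auto simp: feasible_iff c_def)
    have W: "(cmod (W $ i $ k))\<^sup>2 \<le> c" for i k
    proof -
      have "cmod (W $ i $ k) \<le> norm (column k W)"
        using Finite_Cartesian_Product.norm_nth_le[of "column k W" i] by (simp add: column_def)
      then have "(cmod (W $ i $ k))\<^sup>2 \<le> (norm (column k W))\<^sup>2"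
        by (simp add: power_mono)
      also have "\<dots> \<le> p $ k"
        using z by (simp add: feasible_norm_column_le)
      finally show ?thesis
        using p(2) by (rule order_trans)
    qed
    have "(norm W)\<^sup>2 = (\<Sum>i\<in>UNIV. \<Sum>k\<in>UNIV. (cmod (W $ i $ k))\<^sup>2)"
      by (simp add: norm_vec_power2)
    also have "\<dots> \<le> (\<Sum>i\<in>(UNIV :: 'n set). \<Sum>k\<in>(UNIV :: 'k set). c)"
      by (intro sum_mono W)
    finally have "norm W \<le> sqrt (\<Sum>i\<in>(UNIV :: 'n set). \<Sum>k\<in>(UNIV :: 'k set). c)"
      by (rule real_le_rsqrt)
    moreover have "norm p \<le> real CARD('k) * c"
      using norm_le_l1_cart[of p] sum_mono[of UNIV "\<lambda>k. \<bar>p $ k\<bar>" "\<lambda>_. c"] p by simp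
    ultimately show ?thesis
      using norm_Pair_le[of W p] by simp
  qed
  then show ?thesis
    unfolding bounded_iff by blast
qed

lemma compact_feasible:
  fixes aq P_max :: real
  assumes "0 < aq"
  shows "compact (Collect (feasible aq P_max :: (complex^'k^'n) \<times> (real^'k) \<Rightarrow> bool))"
  using bounded_feasible[OF assms] closed_feasible unfolding compact_eq_bounded_closed by blast

section \<open>Existence of an optimum and its projection\<close>

lemma ex_optimal:
  assumes "0 < aq" "0 \<le> bq" "0 < sigma2" "0 < eta_PA" "0 < P_st" "0 \<le> P_max"
  shows "\<exists>z. optimal B aq bq sigma2 eta_PA P_st P_max H z"
proof -
  have "feasible aq P_max (0, 0)"
    using assms by (simp add: feasible_iff)
  then have "Collect (feasible aq P_max) \<noteq> {}"
    by blast
  from continuous_attains_sup[OF compact_feasible[OF assms(1)] this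
      continuous_on_energy_efficiency[OF less_imp_le[OF assms(1)] assms(2-5)]]
  show ?thesis
    by (auto simp: optimal_def is_arg_max_linorder)
qed

theorem lemma1:
  fixes H :: "complex^'n^'k"
    and B sigma2 P_max eta_PA P_st aq bq :: real
  assumes "B > 0" and "sigma2 > 0" and "P_max > 0" and "eta_PA > 0" and "P_st > 0"
    and "0 < bq" and "bq < 1" and "aq = 1 - bq"
    and "CARD('k) \<le> CARD('n)" and "rank H = CARD('k)"
  shows "(\<forall>(W :: complex^'k^'n) (p :: real^'k) W_par.
            feasible aq P_max (W, p) \<and> W_par = proj_matrix H ** W \<longrightarrow>
              (\<forall>k. column k W_par \<in> mat_range (cadjoint H)
                   \<and> (\<forall>v\<in>mat_range (cadjoint H). cinner v (column k W - column k W_par) = 0))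
              \<and> feasible aq P_max (W_par, p)
              \<and> H ** W_par = H ** W
              \<and> tx_power aq (snd (W_par, p)) = tx_power aq (snd (W, p))
              \<and> tx_power aq (snd (W, p)) = aq * (1 \<bullet> p))
       \<and> (\<exists>(W :: complex^'k^'n) (p :: real^'k).
            optimal B aq bq sigma2 eta_PA P_st P_max H (W, p)
            \<and> (\<forall>k. column k W \<in> mat_range (cadjoint H)))"
proof (intro conjI)
  have aq: "0 < aq"
    using assms by simp
  note rank = \<open>rank H = CARD('k)\<close>
  have HP: "H ** (proj_matrix H ** W) = H ** W" for W :: "complex^'k^'n"
    by (simp add: matrix_mul_assoc mult_proj_matrix[OF rank])
  show "\<forall>(W :: complex^'k^'n) (p :: real^'k) W_par.
            feasible aq P_max (W, p) \<and> W_par = proj_matrix H ** W \<longrightarrow>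
              (\<forall>k. column k W_par \<in> mat_range (cadjoint H)
                   \<and> (\<forall>v\<in>mat_range (cadjoint H). cinner v (column k W - column k W_par) = 0))
              \<and> feasible aq P_max (W_par, p)
              \<and> H ** W_par = H ** W
              \<and> tx_power aq (snd (W_par, p)) = tx_power aq (snd (W, p))
              \<and> tx_power aq (snd (W, p)) = aq * (1 \<bullet> p)"
    by (auto simp: column_matrix_mult proj_matrix_in_range proj_matrix_orthogonal[OF rank]
        feasible_proj_matrix[OF rank] HP tx_power_def)
  obtain W :: "complex^'k^'n" and p :: "real^'k"
    where opt: "optimal B aq bq sigma2 eta_PA P_st P_max H (W, p)"
    using ex_optimal[of aq bq sigma2 eta_PA P_st P_max B H] aq assms by fastforce
  \<comment> \<open>Projection keeps the pair feasible and its objective value unchanged, so no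
    feasible pair exceeds the projected one.\<close>
  then have "optimal B aq bq sigma2 eta_PA P_st P_max H (proj_matrix H ** W, p)"
    using feasible_proj_matrix[OF rank, of aq P_max W p] energy_efficiency_cong[OF HP]
    by (simp add: optimal_def is_arg_max_def)
  then show "\<exists>(W :: complex^'k^'n) (p :: real^'k).
            optimal B aq bq sigma2 eta_PA P_st P_max H (W, p)
            \<and> (\<forall>k. column k W \<in> mat_range (cadjoint H))"
    by (metis column_matrix_mult proj_matrix_in_range)
qed

end
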